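(* Fix a non-negative integer $n$ and a positive integer $b$. Let $a_1$ and $a_2$ be any two integers that are relatively prime to $b$. If $r_n(a_1,b)=r_n(a_2,b)$, then \[ b \mid (6n^2+1-a_1a_2)(a_2-a_1). \]
   Context: For real $x$, the sawtooth function is $((x)) = \{x\}-\tfrac12$ if $x\notin\mathbb Z$ and $((x))=0$ if $x\in\mathbb Z$, where $\{x\}=x-\lfloor x\rfloor$. For a non-negative integer $n$, a positive integer $b$ and an integer $a$ relatively prime to $b$, the Dedekind–Rademacher sum is \[ r_n(a,b)=\sum_{k=0}^{b-1}\left(\left(\frac{ka+n}{b}\right)\right)\left(\left(\frac{k}{b}\right)\right). \] *)

theory Defs
  imports Complex_Main
begin

definition sawtooth :: "real \<Rightarrow> real" where
  "sawtooth x = (if x \<in> \<int> then 0 else frac x - 1 / 2)"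

definition dedekind_rademacher_sum :: "nat \<Rightarrow> int \<Rightarrow> nat \<Rightarrow> real" where
  "dedekind_rademacher_sum n a b =
     (\<Sum>k = 0..<b. sawtooth (of_int (int k * a + int n) / of_nat b) * sawtooth (of_nat k / of_nat b))"

end

theory Submission
  imports Defs "HOL-Number_Theory.Cong"
begin

text \<open>
  Put \<open>u k = (k a + n) mod b\<close> and let \<open>k\<^sub>0\<close> be the index with \<open>u k\<^sub>0 = 0\<close>. Expanding the product
  of sawtooths and using that \<open>u\<close> permutes the residues, \<open>4 b\<^sup>2 r\<^sub>n(a,b)\<close> equals
  \<open>4 \<Sum> k u k + 2 b k\<^sub>0\<close> up to a term independent of \<open>a\<close>. On the other hand
  \<open>\<Sum> (k a + n - u k)\<^sup>2\<close> is divisible by \<open>b\<^sup>2\<close>, and \<open>\<Sum> (u k)\<^sup>2\<close> does not depend on \<open>a\<close>, which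
  determines \<open>12 a \<Sum> k u k\<close> modulo \<open>b\<^sup>2\<close>. Equality of two sums, multiplied by \<open>a\<^sub>1 a\<^sub>2\<close>, then
  yields the claim after dividing by \<open>b\<close>.
\<close>

text \<open>When \<open>int b dvd x\<close> the residue is 0 and the extra \<open>int b\<close>
  cancels \<open>- int b\<close>, giving the value 0 at integers. Both cases thus share one integer
  numerator over \<open>2 * b\<close>.\<close>

lemma sawtooth_of_int_div:
  assumes "b > 0"
  shows "sawtooth (of_int x / of_nat b) =
    of_int (2 * (x mod int b) - int b + (if int b dvd x then int b else 0)) / (2 * of_nat b)"
proof -
  have Ints: "(of_int x / of_nat b :: real) \<in> \<int> \<longleftrightarrow> int b dvd x"
    using assms of_int_div_of_int_in_Ints_iff[of x "int b", where ?'a = real] by simp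
  have "frac (of_int x / of_nat b :: real) = of_int (x mod int b) / of_nat b"
  proof -
    have "(of_int x :: real) = of_int (x div int b) * of_nat b + of_int (x mod int b)"
      by (metis div_mult_mod_eq of_int_add of_int_mult of_int_of_nat_eq)
    moreover have "\<lfloor>of_int x / of_nat b :: real\<rfloor> = x div int b"
      using floor_divide_of_int_eq[of x "int b", where ?'a = real] by simp
    ultimately show ?thesis
      using assms by (simp add: frac_def field_simps)
  qed
  then show ?thesis
    using assms by (auto simp: sawtooth_def Ints field_simps)
qed

lemma bij_betw_affine_mod:
  fixes a m n :: int
  assumes "m > 0" "coprime a m"
  shows "bij_betw (\<lambda>k. (k * a + n) mod m) {0..<m} {0..<m}"
proof -
  have inj: "inj_on (\<lambda>k. (k * a + n) mod m) {0..<m}"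
  proof (rule inj_onI)
    fix k l assume kl: "k \<in> {0..<m}" "l \<in> {0..<m}" "(k * a + n) mod m = (l * a + n) mod m"
    then have "[k * a = l * a] (mod m)"
      by (simp add: cong_def [symmetric] cong_add_rcancel)
    then have "[k = l] (mod m)"
      using assms cong_mult_rcancel by blast
    then show "k = l"
      using kl by (simp add: cong_def)
  qed
  have "(\<lambda>k. (k * a + n) mod m) ` {0..<m} \<subseteq> {0..<m}"
    using assms by auto
  with inj show ?thesis
    by (simp add: bij_betw_def endo_inj_surj)
qed

lemma sum_affine_mod:
  fixes a m n :: int
  assumes "m > 0" "coprime a m"
  shows "(\<Sum>k\<in>{0..<m}. f ((k * a + n) mod m)) = (\<Sum>j\<in>{0..<m}. f j)"
  using sum.reindex_bij_betw[OF bij_betw_affine_mod[OF assms]] .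

lemma double_sum_int: "m \<ge> 0 \<Longrightarrow> 2 * (\<Sum>j\<in>{0..<m::int}. j) = m * (m - 1)"
proof (induction m rule: int_ge_induct)
  case (step i)
  have "{0..<i+1} = insert i {0..<i}" using step by auto
  then show ?case using step by (simp add: algebra_simps)
qed simp

lemma six_sum_squares_int:
  "m \<ge> 0 \<Longrightarrow> 6 * (\<Sum>j\<in>{0..<m::int}. j\<^sup>2) = m * (m - 1) * (2 * m - 1)"
proof (induction m rule: int_ge_induct)
  case (step i)
  have "{0..<i+1} = insert i {0..<i}" using step by auto
  then show ?case using step by (simp add: algebra_simps power2_eq_square)
qed simp

definition affine_mod_moment :: "int \<Rightarrow> int \<Rightarrow> int \<Rightarrow> int" where
  "affine_mod_moment n a m = (\<Sum>k\<in>{0..<m}. k * ((k * a + n) mod m))"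

text \<open>Each sawtooth factor has denominator \<open>2 * b\<close>, so the factor
  \<open>4 * b\<^sup>2\<close> turns the whole sum into an integer, to which congruences
  apply.\<close>

lemma dedekind_rademacher_sum_eq:
  assumes "b > 0"
  shows "4 * (of_nat b)\<^sup>2 * dedekind_rademacher_sum n a b =
    of_int (\<Sum>k\<in>{0..<int b}.
      (2 * ((k * a + int n) mod int b) - int b
        + (if (k * a + int n) mod int b = 0 then int b else 0))
      * (2 * k - int b + (if k = 0 then int b else 0)))"
    (is "_ = of_int (\<Sum>k\<in>_. ?F k)")
proof -
  have term_eq: "4 * (of_nat b)\<^sup>2 *
      (sawtooth (of_int (int k * a + int n) / of_nat b) * sawtooth (of_nat k / of_nat b))
      = of_int (?F (int k))" if "k < b" for k
  proof -
    have "int k mod int b = int k" "int b dvd int k \<longleftrightarrow> int k = 0"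
      using that by (auto simp: dvd_imp_le nat_dvd_not_less)
    then have "sawtooth (of_nat k / of_nat b) =
        of_int (2 * int k - int b + (if int k = 0 then int b else 0)) / (2 * of_nat b)"
      using sawtooth_of_int_div[OF assms, of "int k"] by simp
    then show ?thesis
      unfolding sawtooth_of_int_div[OF assms] dvd_eq_mod_eq_0
      using assms by (simp add: power2_eq_square del: of_int_add of_int_diff)
  qed
  have "4 * (of_nat b)\<^sup>2 * dedekind_rademacher_sum n a b = (\<Sum>k=0..<b. of_int (?F (int k)))"
    unfolding dedekind_rademacher_sum_def sum_distrib_left
    by (intro sum.cong refl term_eq) simp
  also have "\<dots> = (\<Sum>k\<in>{0..<int b}. of_int (?F k))"
    by (rule sum.reindex_bij_betw[where h = int]) (simp add: bij_betw_def image_int_atLeastLessThan)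
  finally show ?thesis by simp
qed

text \<open>The linear sums of \<open>k\<close> and of its permuted residue agree, and the
  correction at \<open>k = 0\<close> sees only the residue \<open>n mod m\<close>. Hence
  \<open>a\<close> enters only through the moment and through \<open>k0\<close>, where the
  correction of the first factor sits.\<close>

lemma sum_sawtooth_numerators:
  fixes a m n k0 :: int
  assumes "m > 0" "coprime a m" "k0 \<in> {0..<m}" "(k0 * a + n) mod m = 0"
  shows "(\<Sum>k\<in>{0..<m}.
      (2 * ((k * a + n) mod m) - m + (if (k * a + n) mod m = 0 then m else 0))
      * (2 * k - m + (if k = 0 then m else 0)))
    = 4 * affine_mod_moment n a m + 2 * m * k0
      + (2 * m * (n mod m) - 2 * m\<^sup>2 * (m - 1) + m ^ 3 - 2 * m\<^sup>2 + (if n mod m = 0 then m\<^sup>2 else 0))"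
proof -
  define u where "u k = (k * a + n) mod m" for k
  have zero_iff: "u k = 0 \<longleftrightarrow> k = k0" if "k \<in> {0..<m}" for k
    using bij_betw_affine_mod[OF assms(1,2), of n] that assms(3,4)
    unfolding u_def bij_betw_def inj_on_def by (metis (no_types, lifting))
  have sum_u: "2 * (\<Sum>k\<in>{0..<m}. u k) = m * (m - 1)"
    using sum_affine_mod[OF assms(1,2), of "\<lambda>j. j" n] double_sum_int[of m] assms(1)
    by (simp add: u_def)
  have at_k0: "(\<Sum>k\<in>{0..<m}. if k = k0 then g k else 0) = g k0" for g :: "int \<Rightarrow> int"
    using assms(3) by simp
  have at_0: "(\<Sum>k\<in>{0..<m}. if k = 0 then g k else 0) = g 0" for g :: "int \<Rightarrow> int"
    using assms(1) by simp
  \<comment> \<open>The generic product is separated from the corrections at \<open>k0\<close> and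
    at 0. The product of the two corrections, nonzero only if \<open>k0 = 0\<close>, is booked with
    the one at 0.\<close>
  have "(\<Sum>k\<in>{0..<m}. (2 * u k - m + (if u k = 0 then m else 0)) * (2 * k - m + (if k = 0 then m else 0)))
    = (\<Sum>k\<in>{0..<m}. 4 * (k * u k) - 2 * m * u k - 2 * m * k + m\<^sup>2
        + (if k = k0 then 2 * m * k - m\<^sup>2 else 0)
        + (if k = 0 then 2 * m * u k - m\<^sup>2 + (if u k = 0 then m\<^sup>2 else 0) else 0))"
    by (rule sum.cong) (auto simp: zero_iff algebra_simps power2_eq_square)
  also have "\<dots> = 4 * affine_mod_moment n a m - m * (2 * (\<Sum>k\<in>{0..<m}. u k))
        - m * (2 * (\<Sum>k\<in>{0..<m}. k)) + m ^ 3 + (2 * m * k0 - m\<^sup>2)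
        + (2 * m * u 0 - m\<^sup>2 + (if u 0 = 0 then m\<^sup>2 else 0))"
    unfolding sum.distrib sum_subtractf at_k0 at_0 sum_distrib_left[symmetric]
    using assms(1) by (simp add: affine_mod_moment_def u_def power3_eq_cube power2_eq_square sum_distrib_left[symmetric])
  also have "\<dots> = 4 * affine_mod_moment n a m + 2 * m * k0
      + (2 * m * (n mod m) - 2 * m\<^sup>2 * (m - 1) + m ^ 3 - 2 * m\<^sup>2 + (if n mod m = 0 then m\<^sup>2 else 0))"
    using assms(1) unfolding sum_u double_sum_int[OF less_imp_le[OF assms(1)]]
    by (simp add: u_def algebra_simps power2_eq_square)
  finally show ?thesis by (simp add: u_def)
qed

text \<open>\<open>C\<close> is chosen before \<open>a\<close> and \<open>k\<close>, so one constant
  serves both multipliers and cancels when two sums are compared.\<close>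

lemma dedekind_rademacher_sum_moment:
  assumes "b > 0"
  obtains C where "\<And>a k. coprime a (int b) \<Longrightarrow> k \<in> {0..<int b} \<Longrightarrow> (k * a + int n) mod int b = 0 \<Longrightarrow>
    4 * (of_nat b)\<^sup>2 * dedekind_rademacher_sum n a b
    = of_int (4 * affine_mod_moment (int n) a (int b) + 2 * int b * k + C)"
proof -
  have m: "int b > 0" using assms by simp
  show thesis
    by (rule that, subst dedekind_rademacher_sum_eq[OF assms], subst sum_sawtooth_numerators[OF m], assumption+, rule refl)
qed

text \<open>Since \<open>k * a + n\<close> minus its residue is a multiple of \<open>m\<close>, the
  squares of these differences vanish modulo \<open>m\<^sup>2\<close>. In the expansion the cross
  term carries the moment and all other sums have closed forms.\<close>

lemma affine_mod_moment_cong: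
  fixes a m n :: int
  assumes "m > 0" "coprime a m"
  shows "[12 * a * affine_mod_moment n a m =
    m * ((1 + a\<^sup>2) * ((m - 1) * (2 * m - 1)) + 6 * n * (m - 1) * (a - 1) + 6 * n\<^sup>2)] (mod m\<^sup>2)"
proof -
  define u where "u k = (k * a + n) mod m" for k
  have sum_u: "2 * (\<Sum>k\<in>{0..<m}. u k) = m * (m - 1)"
    using sum_affine_mod[OF assms, of "\<lambda>j. j" n] double_sum_int[of m] assms(1) by (simp add: u_def)
  have sum_u2: "6 * (\<Sum>k\<in>{0..<m}. (u k)\<^sup>2) = m * (m - 1) * (2 * m - 1)"
    using sum_affine_mod[OF assms, of "\<lambda>j. j\<^sup>2" n] six_sum_squares_int[of m] assms(1) by (simp add: u_def)
  have "m\<^sup>2 dvd (k * a + n - u k)\<^sup>2" for k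
    by (simp add: u_def minus_mod_eq_mult_div power_mult_distrib)
  \<comment> \<open>The factor 6 clears the denominators in the closed forms for sums of
    squares.\<close>
  then have "m\<^sup>2 dvd 6 * (\<Sum>k\<in>{0..<m}. (k * a + n - u k)\<^sup>2)"
    by (intro dvd_mult dvd_sum) simp
  also have "(\<Sum>k\<in>{0..<m}. (k * a + n - u k)\<^sup>2)
    = (\<Sum>k\<in>{0..<m}. (u k)\<^sup>2 + a\<^sup>2 * k\<^sup>2 + 2 * a * n * k + n\<^sup>2 - 2 * n * u k - 2 * a * (k * u k))"
    by (rule sum.cong) (auto simp: algebra_simps power2_eq_square)
  also have "\<dots> = (\<Sum>k\<in>{0..<m}. (u k)\<^sup>2) + a\<^sup>2 * (\<Sum>k\<in>{0..<m}. k\<^sup>2) + 2 * a * n * (\<Sum>k\<in>{0..<m}. k)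
      + m * n\<^sup>2 - 2 * n * (\<Sum>k\<in>{0..<m}. u k) - 2 * a * affine_mod_moment n a m"
    unfolding sum.distrib sum_subtractf sum_distrib_left[symmetric]
    using assms(1) by (simp add: affine_mod_moment_def u_def)
  also have "6 * \<dots> = 6 * (\<Sum>k\<in>{0..<m}. (u k)\<^sup>2) + a\<^sup>2 * (6 * (\<Sum>k\<in>{0..<m}. k\<^sup>2))
      + 6 * a * n * (2 * (\<Sum>k\<in>{0..<m}. k))
      + 6 * m * n\<^sup>2 - 6 * n * (2 * (\<Sum>k\<in>{0..<m}. u k)) - 12 * a * affine_mod_moment n a m"
    by (simp add: algebra_simps)
  also have "\<dots> = m * ((1 + a\<^sup>2) * ((m - 1) * (2 * m - 1)) + 6 * n * (m - 1) * (a - 1) + 6 * n\<^sup>2)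
      - 12 * a * affine_mod_moment n a m"
    using assms(1) unfolding sum_u sum_u2 by (simp add: double_sum_int six_sum_squares_int algebra_simps)
  finally show ?thesis
    by (subst cong_sym_eq) (simp add: cong_iff_dvd_diff)
qed

text \<open>Multiplying \<open>eq\<close> by \<open>6 * a1 * a2\<close> produces the terms
  \<open>12 * a * affine_mod_moment n a m\<close>, known modulo \<open>m\<^sup>2\<close>. After
  cancelling one \<open>m\<close>, the terms linear in \<open>n\<close> reduce modulo
  \<open>m\<close> to \<open>- 6 * n * a1 * a2\<close> on both sides, because \<open>k1 * a1\<close>
  and \<open>k2 * a2\<close> are both congruent to \<open>- n\<close>.\<close>

lemma dvd_of_moment_eq:
  fixes m n a1 a2 k1 k2 :: int
  assumes m: "m > 0" and cop: "coprime a1 m" "coprime a2 m"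
    and k1: "m dvd k1 * a1 + n" and k2: "m dvd k2 * a2 + n"
    and eq: "2 * affine_mod_moment n a1 m + m * k1 = 2 * affine_mod_moment n a2 m + m * k2"
  shows "m dvd (6 * n\<^sup>2 + 1 - a1 * a2) * (a2 - a1)"
proof -
  define R where "R a = (1 + a\<^sup>2) * ((m - 1) * (2 * m - 1)) + 6 * n * (m - 1) * (a - 1) + 6 * n\<^sup>2" for a
  obtain p1 where p1: "12 * a1 * affine_mod_moment n a1 m = m * R a1 + m\<^sup>2 * p1"
    using affine_mod_moment_cong[OF m cop(1), of n, folded R_def, THEN cong_sym] cong_iff_lin by blast
  obtain p2 where p2: "12 * a2 * affine_mod_moment n a2 m = m * R a2 + m\<^sup>2 * p2"
    using affine_mod_moment_cong[OF m cop(2), of n, folded R_def, THEN cong_sym] cong_iff_lin by blast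
  obtain q1 where q1: "k1 * a1 = m * q1 - n" using k1 by (metis dvdE add_diff_cancel_right')
  obtain q2 where q2: "k2 * a2 = m * q2 - n" using k2 by (metis dvdE add_diff_cancel_right')
  have "a2 * (12 * a1 * affine_mod_moment n a1 m) + 6 * m * a2 * (k1 * a1)
      = a1 * (12 * a2 * affine_mod_moment n a2 m) + 6 * m * a1 * (k2 * a2)"
    using arg_cong[OF eq, of "\<lambda>x. 6 * a1 * a2 * x"] by (simp add: algebra_simps)
  then have "m * (a2 * (R a1 + m * p1) + 6 * a2 * (m * q1 - n))
      = m * (a1 * (R a2 + m * p2) + 6 * a1 * (m * q2 - n))"
    unfolding p1 p2 q1 q2 by (simp add: algebra_simps power2_eq_square)
  then have *: "a2 * (R a1 + m * p1) + 6 * a2 * (m * q1 - n)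
      = a1 * (R a2 + m * p2) + 6 * a1 * (m * q2 - n)"
    using m by simp
  \<comment> \<open>The cofactor collects the multiples of \<open>m\<close> in \<open>*\<close>; the
    part with \<open>2 * m - 3\<close> comes from
    \<open>(m - 1) * (2 * m - 1) = 1 + m * (2 * m - 3)\<close>.\<close>
  have "(6 * n\<^sup>2 + 1 - a1 * a2) * (a2 - a1)
      = m * (a1 * p2 + 6 * a1 * q2 - a2 * p1 - 6 * a2 * q1
          - (2 * m - 3) * (1 - a1 * a2) * (a2 - a1) - 6 * n * (a1 - a2))"
    using * unfolding R_def by algebra
  then show ?thesis by simp
qed

theorem theorem2:
  fixes n b :: nat and a1 a2 :: int
  assumes "b > 0"
    and "coprime a1 (int b)"
    and "coprime a2 (int b)"
    and "dedekind_rademacher_sum n a1 b = dedekind_rademacher_sum n a2 b"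
  shows "int b dvd (6 * (int n)\<^sup>2 + 1 - a1 * a2) * (a2 - a1)"
proof -
  have m: "int b > 0" using assms(1) by simp
  \<comment> \<open>The index with residue 0 exists because the affine map is onto the
    residues.\<close>
  have root: "\<exists>k\<in>{0..<int b}. (k * a + int n) mod int b = 0" if "coprime a (int b)" for a
  proof -
    have "0 \<in> (\<lambda>k. (k * a + int n) mod int b) ` {0..<int b}"
      using bij_betw_affine_mod[OF m that, of "int n"] m by (simp add: bij_betw_def)
    then show ?thesis by force
  qed
  obtain k1 where k1: "k1 \<in> {0..<int b}" "(k1 * a1 + int n) mod int b = 0"
    by (rule bexE[OF root[OF assms(2)]])
  obtain k2 where k2: "k2 \<in> {0..<int b}" "(k2 * a2 + int n) mod int b = 0"
    by (rule bexE[OF root[OF assms(3)]])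
  obtain C where C: "\<And>a k. coprime a (int b) \<Longrightarrow> k \<in> {0..<int b} \<Longrightarrow> (k * a + int n) mod int b = 0 \<Longrightarrow>
      4 * (of_nat b)\<^sup>2 * dedekind_rademacher_sum n a b
      = of_int (4 * affine_mod_moment (int n) a (int b) + 2 * int b * k + C)"
    by (rule dedekind_rademacher_sum_moment[OF assms(1), of n]) (rule that, simp only:)
  have "real_of_int (4 * affine_mod_moment (int n) a1 (int b) + 2 * int b * k1 + C)
      = of_int (4 * affine_mod_moment (int n) a2 (int b) + 2 * int b * k2 + C)"
    by (simp only: C[OF assms(2) k1, symmetric] C[OF assms(3) k2, symmetric] assms(4))
  then have "2 * affine_mod_moment (int n) a1 (int b) + int b * k1
      = 2 * affine_mod_moment (int n) a2 (int b) + int b * k2"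
    unfolding of_int_eq_iff by linarith
  then show ?thesis
    by (rule dvd_of_moment_eq[OF m assms(2,3) k1(2)[folded dvd_eq_mod_eq_0] k2(2)[folded dvd_eq_mod_eq_0]])
qed

end
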